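(* Consider the system of ordinary differential equations, for $i\in\{1,\ldots,n\}$ and $t\ge0$, $$\begin{aligned} \dot X_i &= \Lambda^3_i[B_{li}]_{\rm C}^{\rm T}-\sum_{j=1}^n a_{i,j}(\Lambda^1_i-\Lambda^1_j)-\sum_{j=1}^n a_{i,j}(X_i-X_j),\\ \dot Y_{vi} &= -A_{li}^{\rm T}(A_{li}Y_{vi}-[F_{vi}]_{\rm R}-U_i)-[I_{r_i}]_{\rm C}\Lambda^3_i,\\ \dot U_i &= A_{li}Y_{vi}-[F_{vi}]_{\rm R}-U_i-\Lambda^2_i,\\ \dot W_i &= \sum_{j=1}^n a_{i,j}(\Lambda^2_i-\Lambda^2_j),\qquad \dot Z_i = \sum_{j=1}^n a_{i,j}(\Lambda^3_i-\Lambda^3_j),\\ \dot\Lambda^1_i &= \sum_{j=1}^n a_{i,j}(X_i-X_j),\\ \dot\Lambda^2_i &= U_i+\dot U_i-\sum_{j=1}^n a_{i,j}(W_i-W_j)-\sum_{j=1}^n a_{i,j}(\Lambda^2_i-\Lambda^2_j),\\ \dot\Lambda^3_i &= [Y_{vi}]_{\rm R}+[\dot Y_{vi}]_{\rm R}-X_i[B_{li}]_{\rm C}-\sum_{j=1}^n a_{i,j}(Z_i-Z_j)-\sum_{j=1}^n a_{i,j}(\Lambda^3_i-\Lambda^3_j), \end{aligned}$$ where $\dot Y_{vi},\dot U_i$ on the right-hand sides stand for the expressions in the second and third lines, with state variables $X_i,\Lambda^1_i\in\mathbb R^{r\times p}$, $Y_{vi}\in\mathbb R^{r_i\times q}$,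 $U_i,W_i,\Lambda^2_i\in\mathbb R^{m\times q}$, $Z_i,\Lambda^3_i\in\mathbb R^{r\times q}$ and arbitrary initial conditions. If the undirected graph $\mathcal G$ is connected, then: 1) every equilibrium of this system is Lyapunov stable, and its trajectory is bounded for any initial condition; 2) the trajectory of this system is exponentially convergent, and $X_i(t)$ converges exponentially to a least squares solution of $AXB=F$ for all $i\in\{1,\ldots,n\}$.
   Context: $A\in\mathbb R^{m\times r}$, $B\in\mathbb R^{p\times q}$, $F\in\mathbb R^{m\times q}$ are partitioned (Column-Column-Row structure) as $A=[A_{l1},\ldots,A_{ln}]$, $B=[B_{l1},\ldots,B_{ln}]$, $F=[F_{v1}^{\rm T},\ldots,F_{vn}^{\rm T}]^{\rm T}$ with $A_{li}\in\mathbb R^{m\times r_i}$, $B_{li}\in\mathbb R^{p\times q_i}$, $F_{vi}\in\mathbb R^{m_i\times q}$, $\sum_i r_i=r$, $\sum_i q_i=q$, $\sum_i m_i=m$. Augmented matrices: for $M\in\mathbb R^{r_i\times q}$ (such as $Y_{vi}$ or $\dot Y_{vi}$), $[M]_{\rm R}\in\mathbb R^{r\times q}$ has $i$th row-block (partition $r_1,\ldots,r_n$) equal to $M$ and zeros elsewhere; $[F_{vi}]_{\rm R}\in\mathbb R^{m\times q}$ has $i$th row-block (partition $m_1,\ldots,m_n$) equal to $F_{vi}$ and zeros elsewhere; $[B_{li}]_{\rm C}\in\mathbb R^{p\times q}$ has $i$th column-block (partition $q_1,\ldots,q_n$) equal to $B_{li}$ and zeros elsewhere; $[I_{r_i}]_{\rm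 C}\in\mathbb R^{r_i\times r}$ has $i$th column-block (partition $r_1,\ldots,r_n$) equal to $I_{r_i}$ and zeros elsewhere. $\mathcal G$ is an undirected graph on $\{1,\ldots,n\}$ with symmetric adjacency matrix $[a_{i,j}]$, $a_{i,j}=a_{j,i}>0$ if $\{j,i\}$ is an edge and $a_{i,j}=0$ otherwise. A least squares solution to $AXB=F$ is a minimizer of $\|AXB-F\|_{\rm F}^2$ over $X\in\mathbb R^{r\times p}$. An equilibrium $z$ is Lyapunov stable if for every $\epsilon>0$ there is $\delta>0$ such that every solution starting in the open ball of radius $\delta$ about $z$ stays in the open ball of radius $\epsilon$ about $z$ for all $t\ge0$. A trajectory converges exponentially to $z^*$ if its distance to $z^*$ is at most $c\,e^{-\mu t}$ for some $c\ge0$, $\mu>0$ and all $t\ge0$; "exponentially convergent" means converging exponentially to some equilibrium (possibly depending on the initial condition). *)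

theory Defs
  imports "HOL-Analysis.Analysis"
begin

text \<open>
  A real matrix with rows indexed by \<open>'a\<close> and columns indexed by \<open>'b\<close> is an element of
  \<open>real ^ 'b ^ 'a\<close>; its library norm is the Frobenius norm, and the library norm on tuples and
  families of matrices is the root of the sum of squared Frobenius norms.

  The agents \<open>1, ..., n\<close> are the elements of a finite type \<open>'n\<close>. A partition of an index set
  \<open>'k\<close> into \<open>n\<close> blocks is given by a map \<open>\<beta> :: 'k \<Rightarrow> 'n\<close>: block \<open>i\<close> is \<open>{k. \<beta> k = i}\<close>, and its
  size (\<open>r\<^sub>i\<close>, \<open>q\<^sub>i\<close> or \<open>m\<^sub>i\<close>) is the cardinality of that set, so that the sizes add up to
  \<open>CARD('k)\<close>. Contiguous blocks are the special case of a monotone \<open>\<beta>\<close>.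

  As the number of rows of a block depends on \<open>i\<close>, a family of row blocks \<open>M\<^bsub>v1\<^esub>, ..., M\<^bsub>vn\<^esub>\<close> is
  represented by the stacked matrix \<open>M\<close>: row \<open>k\<close> of \<open>M\<close> is the row of \<open>M\<^bsub>vi\<^esub>\<close> with index \<open>k\<close>,
  where \<open>i = \<beta> k\<close>. Similarly for column blocks.
\<close>

subsection \<open>Augmented matrices and block products\<close>

text \<open>\<open>[M\<^bsub>vi\<^esub>]\<^bsub>R\<^esub>\<close>: the \<open>i\<close>th row block of \<open>M\<close>, padded with zero rows.\<close>

definition row_aug :: "('k \<Rightarrow> 'n) \<Rightarrow> 'n \<Rightarrow> real ^ 'c ^ 'k \<Rightarrow> real ^ 'c ^ 'k" where
  "row_aug \<beta> i M = (\<chi> k c. if \<beta> k = i then M $ k $ c else 0)"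

text \<open>\<open>[M\<^bsub>li\<^esub>]\<^bsub>C\<^esub>\<close>: the \<open>i\<close>th column block of \<open>M\<close>, padded with zero columns.\<close>

definition col_aug :: "('k \<Rightarrow> 'n) \<Rightarrow> 'n \<Rightarrow> real ^ 'k ^ 'c \<Rightarrow> real ^ 'k ^ 'c" where
  "col_aug \<beta> i M = (\<chi> c k. if \<beta> k = i then M $ c $ k else 0)"

text \<open>\<open>A\<^bsub>li\<^esub> Y\<^bsub>vi\<^esub>\<close>: product of the \<open>i\<close>th column block of \<open>A\<close> and the \<open>i\<close>th row block of \<open>Y\<close>.\<close>

definition block_mult ::
  "('k::finite \<Rightarrow> 'n) \<Rightarrow> 'n \<Rightarrow> real ^ 'k ^ 'c \<Rightarrow> real ^ 'd ^ 'k \<Rightarrow> real ^ 'd ^ 'c" where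
  "block_mult \<beta> i A Y = (\<chi> c d. \<Sum>k | \<beta> k = i. A $ c $ k * Y $ k $ d)"

subsection \<open>Graphs\<close>

definition undirected_graph :: "'n set set \<Rightarrow> bool" where
  "undirected_graph E \<longleftrightarrow> (\<forall>e\<in>E. \<exists>i j. i \<noteq> j \<and> e = {i, j})"

definition weighted_adjacency :: "'n set set \<Rightarrow> real ^ 'n ^ 'n \<Rightarrow> bool" where
  "weighted_adjacency E a \<longleftrightarrow>
     (\<forall>i j. a $ i $ j = a $ j $ i \<and>
            (if {j, i} \<in> E then a $ i $ j > 0 else a $ i $ j = 0))"

definition graph_connected :: "'n set set \<Rightarrow> bool" where
  "graph_connected E \<longleftrightarrow> (\<forall>i j. (i, j) \<in> {(u, v). {u, v} \<in> E}\<^sup>*)"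

text \<open>\<open>\<Sum>\<^sub>j a\<^bsub>i,j\<^esub> (V\<^sub>i - V\<^sub>j)\<close>\<close>

definition coupling ::
  "real ^ 'n ^ 'n \<Rightarrow> ('v::real_vector) ^ 'n \<Rightarrow> 'n::finite \<Rightarrow> 'v" where
  "coupling a V i = (\<Sum>j\<in>UNIV. a $ i $ j *\<^sub>R (V $ i - V $ j))"

subsection \<open>The system of differential equations\<close>

text \<open>
  A state consists, in this order, of the families \<open>X\<close>, \<open>Y\<^sub>v\<close>, \<open>U\<close>, \<open>W\<close>, \<open>Z\<close>,
  \<open>\<Lambda>\<^sup>1\<close>, \<open>\<Lambda>\<^sup>2\<close>, \<open>\<Lambda>\<^sup>3\<close>; the blocks \<open>Y\<^bsub>vi\<^esub>\<close> are stacked.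
\<close>

type_synonym ('m, 'r, 'p, 'q, 'n) state =
  "(real ^ 'p ^ 'r ^ 'n) \<times> (real ^ 'q ^ 'r) \<times> (real ^ 'q ^ 'm ^ 'n) \<times> (real ^ 'q ^ 'm ^ 'n) \<times>
   (real ^ 'q ^ 'r ^ 'n) \<times> (real ^ 'p ^ 'r ^ 'n) \<times> (real ^ 'q ^ 'm ^ 'n) \<times> (real ^ 'q ^ 'r ^ 'n)"

text \<open>
  \<open>\<rho>\<close>, \<open>\<kappa>\<close> and \<open>\<mu>\<close> give the partitions into blocks of sizes \<open>r\<^sub>i\<close>, \<open>q\<^sub>i\<close> and \<open>m\<^sub>i\<close>.
  In row \<open>k\<close> of \<open>Ydot\<close>, with \<open>i = \<rho> k\<close>: row \<open>k\<close> of \<open>A\<^sup>T N\<close> is the row of \<open>A\<^bsub>li\<^esub>\<^sup>T N\<close> with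
  index \<open>k\<close>, and row \<open>k\<close> of \<open>\<Lambda>\<^sup>3\<^sub>i\<close> is the row of \<open>[I]\<^bsub>C\<^esub> \<Lambda>\<^sup>3\<^sub>i\<close> with index \<open>k\<close>.
\<close>

definition ccr_field ::
  "real ^ 'r ^ 'm \<Rightarrow> real ^ 'q ^ 'p \<Rightarrow> real ^ 'q ^ 'm \<Rightarrow>
   ('r \<Rightarrow> 'n) \<Rightarrow> ('q \<Rightarrow> 'n) \<Rightarrow> ('m \<Rightarrow> 'n) \<Rightarrow> real ^ 'n ^ 'n \<Rightarrow>
   ('m::finite, 'r::finite, 'p::finite, 'q::finite, 'n::finite) state \<Rightarrow>
   ('m, 'r, 'p, 'q, 'n) state" where
  "ccr_field A B F \<rho> \<kappa> \<mu> a = (\<lambda>(X, Y, U, W, Z, L1, L2, L3).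
     let
       E = (\<lambda>i. block_mult \<rho> i A Y - row_aug \<mu> i F - U $ i);
       Ydot = (\<chi> k. - ((transpose A ** E (\<rho> k)) $ k) - L3 $ \<rho> k $ k);
       Udot = (\<chi> i. E i - L2 $ i)
     in
      (\<chi> i. L3 $ i ** transpose (col_aug \<kappa> i B) - coupling a L1 i - coupling a X i,
       Ydot,
       Udot,
       \<chi> i. coupling a L2 i,
       \<chi> i. coupling a L3 i,
       \<chi> i. coupling a X i,
       \<chi> i. U $ i + Udot $ i - coupling a W i - coupling a L2 i,
       \<chi> i. row_aug \<rho> i Y + row_aug \<rho> i Ydot - X $ i ** col_aug \<kappa> i B
             - coupling a Z i - coupling a L3 i))"

subsection \<open>Trajectories, stability and convergence\<close>

definition is_trajectory :: "('s::real_normed_vector \<Rightarrow> 's) \<Rightarrow> (real \<Rightarrow> 's) \<Rightarrow> bool" where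
  "is_trajectory f x \<longleftrightarrow> (\<forall>t\<ge>0. (x has_vector_derivative f (x t)) (at t within {0..}))"

definition is_equilibrium :: "('s::real_normed_vector \<Rightarrow> 's) \<Rightarrow> 's \<Rightarrow> bool" where
  "is_equilibrium f z \<longleftrightarrow> f z = 0"

definition lyapunov_stable :: "('s::real_normed_vector \<Rightarrow> 's) \<Rightarrow> 's \<Rightarrow> bool" where
  "lyapunov_stable f z \<longleftrightarrow>
     (\<forall>\<epsilon>>0. \<exists>\<delta>>0. \<forall>x. is_trajectory f x \<longrightarrow> x 0 \<in> ball z \<delta> \<longrightarrow> (\<forall>t\<ge>0. x t \<in> ball z \<epsilon>))"

definition converges_exponentially :: "(real \<Rightarrow> 's::metric_space) \<Rightarrow> 's \<Rightarrow> bool" where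
  "converges_exponentially x z \<longleftrightarrow>
     (\<exists>c\<ge>0. \<exists>\<nu>>0. \<forall>t\<ge>0. dist (x t) z \<le> c * exp (- \<nu> * t))"

definition least_squares_solution ::
  "real ^ 'r ^ 'm \<Rightarrow> real ^ 'q ^ 'p \<Rightarrow> real ^ 'q ^ 'm \<Rightarrow> real ^ 'p ^ 'r \<Rightarrow> bool" where
  "least_squares_solution A B F X \<longleftrightarrow>
     is_arg_min (\<lambda>X. (norm (A ** X ** B - F))\<^sup>2) (\<lambda>_. True) X"

end

theory Submission
  imports Defs
begin

text \<open>
  The vector field is affine, with linear part \<open>M\<close>. Along a solution of the linear system,
  \<open>\<bar>s\<bar>\<^sup>2 / 2 + (\<Sum>\<^sub>i \<bar>A\<^bsub>li\<^esub> Y\<^bsub>vi\<^esub> - U\<^sub>i\<bar>\<^sup>2) / 2\<close> has a nonpositive derivative: the second summand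
  produces \<open>- \<bar>Ydot\<bar>\<^sup>2 - \<bar>Udot\<bar>\<^sup>2\<close> and cancels the cross terms due to the derivative feedback in
  the equations of \<open>\<Lambda>\<^sup>2\<close> and \<open>\<Lambda>\<^sup>3\<close>. This gives stability. If the dissipation vanishes both at \<open>s\<close>
  and at \<open>M s\<close>, then \<open>M s = 0\<close>. For a trajectory \<open>x\<close> the velocity solves the linear system and
  is orthogonal to the kernel of \<open>M\<close> in the energy inner product, where this observability makes a
  perturbed energy decay exponentially. An exponentially decaying velocity forces \<open>x\<close> to converge to
  an equilibrium, without knowing in advance that one exists. Summing the equilibrium equations over
  all agents cancels the couplings and leaves the normal equations of the least squares problem.
\<close>

section \<open>Exponential convergence from a semidefinite Lyapunov function\<close>

lemma at_within_atLeast_eq_at: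
  fixes u :: real
  assumes "a < u"
  shows "at u within {a..} = at u"
  by (rule at_within_open_subset[of _ "{a<..}"]) (use assms in auto)

text \<open>The derivative relative to \<open>{0..}\<close> is one-sided only at 0. Interior points
  therefore carry an ordinary derivative, and continuity covers the endpoints.\<close>

lemma nonincreasing_from_derivative:
  fixes g :: "real \<Rightarrow> real"
  assumes "\<And>t. t \<ge> 0 \<Longrightarrow> (g has_vector_derivative g' t) (at t within {0..})"
    and "\<And>t. t \<ge> 0 \<Longrightarrow> g' t \<le> 0" and "0 \<le> s" "s \<le> t"
  shows "g t \<le> g s"
proof (rule DERIV_nonpos_imp_decreasing_open[OF \<open>s \<le> t\<close>])
  fix u assume u: "s < u" "u < t"
  have "at u within {0..} = at u"
    using u \<open>0 \<le> s\<close> by (intro at_within_atLeast_eq_at) simp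
  then show "\<exists>y. (g has_real_derivative y) (at u) \<and> y \<le> 0"
    using assms(1)[of u] assms(2)[of u] u \<open>0 \<le> s\<close>
    by (auto simp: has_real_derivative_iff_has_vector_derivative)
next
  have "continuous_on {0..} g"
    using assms(1) by (auto intro: continuous_on_vector_derivative)
  then show "continuous_on {s..t} g"
    by (rule continuous_on_subset) (use \<open>0 \<le> s\<close> in auto)
qed

lemma exp_neg_tendsto_0:
  fixes C :: real
  assumes "\<nu> > 0"
  shows "(\<lambda>n. C * exp (- \<nu> * real n)) \<longlonglongrightarrow> 0"
proof -
  have "(\<lambda>n. C * exp (- \<nu>) ^ n) \<longlonglongrightarrow> C * 0"
    using assms by (intro tendsto_intros LIMSEQ_power_zero) simp
  then show ?thesis by (simp add: mult.commute flip: exp_of_nat_mult)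
qed

text \<open>The velocity bound has a finite integral, so the curve has a Cauchy tail; completeness
  supplies the limit, and the tail integral is the rate of approach.\<close>

lemma exponentially_decaying_velocity_imp_convergence:
  fixes x v :: "real \<Rightarrow> 'a::banach"
  assumes deriv: "\<And>t. t \<ge> 0 \<Longrightarrow> (x has_vector_derivative v t) (at t within {0..})"
    and bound: "\<And>t. t \<ge> 0 \<Longrightarrow> norm (v t) \<le> C * exp (- \<nu> * t)"
    and "C \<ge> 0" "\<nu> > 0"
  obtains z where "\<And>t. t \<ge> 0 \<Longrightarrow> dist (x t) z \<le> C / \<nu> * exp (- \<nu> * t)"
    and "(\<lambda>n. x (real n)) \<longlonglongrightarrow> z"
proof -
  \<comment> \<open>An antiderivative of the velocity bound that increases to 0, so
    \<open>\<phi> t - \<phi> s\<close> is at most \<open>- \<phi> s\<close>, uniformly in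
    \<open>t\<close>.\<close>
  define \<phi> where "\<phi> t = - (C / \<nu>) * exp (- \<nu> * t)" for t
  have step: "norm (x t - x s) \<le> C / \<nu> * exp (- \<nu> * s)" if "0 \<le> s" "s < t" for s t
  proof -
    have "norm (x t - x s) \<le> \<phi> t - \<phi> s"
    proof (rule differentiable_bound_general[OF \<open>s < t\<close>])
      have "continuous_on {0..} x"
        using deriv by (auto intro: continuous_on_vector_derivative)
      then show "continuous_on {s..t} x"
        by (rule continuous_on_subset) (use that in auto)
      show "continuous_on {s..t} \<phi>"
        unfolding \<phi>_def by (intro continuous_intros)
    next
      fix u assume u: "s < u" "u < t"
      have "at u within {0..} = at u"
        using u that by (intro at_within_atLeast_eq_at) simp
      then show "(x has_vector_derivative v u) (at u)"
        using deriv[of u] u that by simp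
      have "(\<phi> has_real_derivative C * exp (- \<nu> * u)) (at u)"
        unfolding \<phi>_def using \<open>\<nu> > 0\<close> by (auto intro!: derivative_eq_intros)
      then show "(\<phi> has_vector_derivative C * exp (- \<nu> * u)) (at u)"
        by (simp add: has_real_derivative_iff_has_vector_derivative)
      show "norm (v u) \<le> C * exp (- \<nu> * u)"
        using bound u that by simp
    qed
    also have "\<dots> \<le> C / \<nu> * exp (- \<nu> * s)"
      using \<open>C \<ge> 0\<close> \<open>\<nu> > 0\<close> by (simp add: \<phi>_def)
    finally show ?thesis .
  qed
  have lim0: "(\<lambda>n. C / \<nu> * exp (- \<nu> * real n)) \<longlonglongrightarrow> 0"
    by (rule exp_neg_tendsto_0) fact
  have "Cauchy (\<lambda>n. x (real n))"
  proof (rule CauchyI')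
    fix e :: real assume "e > 0"
    then have "\<forall>\<^sub>F n in sequentially. C / \<nu> * exp (- \<nu> * real n) < e"
      using lim0 order_tendstoD(2) by blast
    then obtain N where N: "C / \<nu> * exp (- \<nu> * real n) < e" if "n \<ge> N" for n
      by (auto simp: eventually_sequentially)
    show "\<exists>M. \<forall>m\<ge>M. \<forall>n>m. dist (x (real m)) (x (real n)) < e"
    proof (intro exI[of _ N] allI impI)
      fix m n :: nat assume "N \<le> m" "m < n"
      then show "dist (x (real m)) (x (real n)) < e"
        using step[of "real m" "real n"] N[of m] by (simp add: dist_norm norm_minus_commute)
    qed
  qed
  then obtain z where z: "(\<lambda>n. x (real n)) \<longlonglongrightarrow> z"
    using convergent_eq_Cauchy by blast
  show ?thesis
  proof
    fix s :: real assume "s \<ge> 0"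
    \<comment> \<open>The bound of \<open>step\<close> does not depend on the later time, so it
      survives sending that time to infinity.\<close>
    have "(\<lambda>n. dist (x s) (x (real n))) \<longlonglongrightarrow> dist (x s) z"
      by (intro tendsto_intros z)
    moreover have "\<forall>\<^sub>F n in sequentially. dist (x s) (x (real n)) \<le> C / \<nu> * exp (- \<nu> * s)"
    proof -
      have "\<forall>\<^sub>F n in sequentially. real n > s"
        using filterlim_real_sequentially by (simp add: filterlim_at_top_dense)
      then show ?thesis
        by eventually_elim
          (use step \<open>s \<ge> 0\<close> in \<open>simp add: dist_norm norm_minus_commute\<close>)
    qed
    ultimately show "dist (x s) z \<le> C / \<nu> * exp (- \<nu> * s)"
      by (rule tendsto_upperbound) simp
  qed (fact z)
qed

section \<open>Abstract dissipative affine systems\<close>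

lemma linear_inner_bound:
  fixes f g :: "'a::euclidean_space \<Rightarrow> 'b::real_inner"
  assumes "linear f" "linear g"
  obtains K where "K > 0" "\<And>y. \<bar>f y \<bullet> g y\<bar> \<le> K * (norm y)\<^sup>2"
proof -
  obtain K1 where K1: "K1 > 0" "\<And>y. norm (f y) \<le> K1 * norm y"
    using linear_bounded_pos[OF assms(1)] by blast
  obtain K2 where K2: "K2 > 0" "\<And>y. norm (g y) \<le> K2 * norm y"
    using linear_bounded_pos[OF assms(2)] by blast
  have "\<bar>f y \<bullet> g y\<bar> \<le> (K1 * K2) * (norm y)\<^sup>2" for y
  proof -
    have "\<bar>f y \<bullet> g y\<bar> \<le> norm (f y) * norm (g y)"
      by (rule Cauchy_Schwarz_ineq2)
    also have "\<dots> \<le> (K1 * norm y) * (K2 * norm y)"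
      using K1 K2 by (intro mult_mono) auto
    finally show ?thesis by (simp add: power2_eq_square algebra_simps)
  qed
  then show thesis using that[of "K1 * K2"] K1(1) K2(1) by simp
qed

lemma abs_half_le:
  fixes p q :: real
  assumes "\<bar>p\<bar> \<le> a" "\<bar>q\<bar> \<le> b" "a + b \<le> k" "0 \<le> k"
  shows "\<bar>- (p + q) / 2\<bar> \<le> k"
  using assms by (auto simp: abs_le_iff)

text \<open>\<open>T\<close> embeds the state into a larger Euclidean space, so that
  \<open>T y \<bullet> T z\<close> is the energy inner product. \<open>detectable\<close> is an
  observability condition of order one: dissipation that vanishes at a state and at its velocity
  forces rest. \<open>offset_orthogonal\<close> keeps the offset from causing drift along the kernel
  of \<open>M\<close>.\<close>

locale dissipative_affine_system =
  fixes M :: "'s::euclidean_space \<Rightarrow> 's" and T :: "'s \<Rightarrow> 't::euclidean_space" and b :: 's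
  assumes linear_M: "linear M" and linear_T: "linear T"
    and norm_le_T: "norm y \<le> norm (T y)"
    and dissipative: "T y \<bullet> T (M y) \<le> 0"
    and detectable: "T y \<bullet> T (M y) = 0 \<Longrightarrow> T (M y) \<bullet> T (M (M y)) = 0 \<Longrightarrow> M y = 0"
    and offset_orthogonal: "M k = 0 \<Longrightarrow> T k \<bullet> T b = 0"
begin

definition D where "D y = - (T y \<bullet> T (M y))"

text \<open>The symmetric bilinear form of the quadratic form \<open>D\<close>:
  \<open>polar y y = D y\<close>.\<close>

definition polar where "polar y z = - (T y \<bullet> T (M z) + T z \<bullet> T (M y)) / 2"

text \<open>The orthogonal complement of the kernel of \<open>M\<close> in the energy inner
  product.\<close>

definition S where "S = {y. \<forall>k. M k = 0 \<longrightarrow> T k \<bullet> T y = 0}"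

lemma D_nonneg: "D y \<ge> 0"
  using dissipative[of y] by (simp add: D_def)

lemma D_add_scaleR: "D (y + e *\<^sub>R z) = D y + 2 * e * polar y z + e\<^sup>2 * D z"
  by (simp add: D_def polar_def linear_add[OF linear_M] linear_add[OF linear_T]
      linear_cmul[OF linear_M] linear_cmul[OF linear_T] inner_add_left inner_add_right
      power2_eq_square algebra_simps)

lemma bounded_linear_M: "bounded_linear M" and bounded_linear_T: "bounded_linear T"
  using linear_M linear_T linear_conv_bounded_linear by blast+

text \<open>Adding multiples of \<open>k\<close> to \<open>y\<close> changes the energy derivative
  affinely with slope \<open>T k \<bullet> T (M y)\<close>. Being nonpositive everywhere, it must
  have slope zero.\<close>

lemma kernel_orthogonal_range:
  assumes "M k = 0"
  shows "T k \<bullet> T (M y) = 0"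
proof (rule ccontr)
  assume nz: "T k \<bullet> T (M y) \<noteq> 0"
  define c where "c = T k \<bullet> T (M y)"
  \<comment> \<open>Solves the affine equation for the value 1, which contradicts
    dissipativity.\<close>
  define e where "e = (1 - T y \<bullet> T (M y)) / c"
  have "T (e *\<^sub>R k + y) \<bullet> T (M (e *\<^sub>R k + y)) = e * c + T y \<bullet> T (M y)"
    by (simp add: assms c_def linear_add[OF linear_M] linear_add[OF linear_T]
        linear_cmul[OF linear_M] linear_cmul[OF linear_T] inner_add_left)
  also have "\<dots> = 1" using nz by (simp add: e_def c_def)
  finally show False using dissipative[of "e *\<^sub>R k + y"] by simp
qed

lemma field_in_S: "M x + b \<in> S"
  by (simp add: S_def linear_add[OF linear_T] inner_add_right kernel_orthogonal_range
      offset_orthogonal)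

lemma closed_S: "closed S"
proof -
  have "S = (\<Inter>k\<in>{k. M k = 0}. {y. T k \<bullet> T y = 0})"
    by (auto simp: S_def)
  also have "closed \<dots>"
    by (intro closed_INT ballI closed_Collect_eq continuous_intros
        linear_continuous_on bounded_linear_T)
  finally show ?thesis .
qed

text \<open>Detectability makes \<open>D y + D (M y)\<close> vanish only on the kernel of
  \<open>M\<close>, which meets \<open>S\<close> only in 0. Compactness of the unit sphere in
  \<open>S\<close> and homogeneity of degree two then give a uniform constant.\<close>

lemma coercive:
  obtains c where "c > 0" "\<And>y. y \<in> S \<Longrightarrow> c * (norm y)\<^sup>2 \<le> D y + D (M y)"
\<comment> \<open>If \<open>S\<close> is trivial there is no minimum to take, and any positive
  constant works.\<close>
proof (cases "sphere 0 1 \<inter> S = {}")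
  case True
  have zero: "y = 0" if "y \<in> S" for y
  proof (rule ccontr)
    assume "y \<noteq> 0"
    then have "y /\<^sub>R norm y \<in> sphere 0 1 \<inter> S"
      using that by (simp add: S_def linear_cmul[OF linear_T])
    then show False using True by blast
  qed
  then have "1 * (norm y)\<^sup>2 \<le> D y + D (M y)" if "y \<in> S" for y
    using zero[OF that] D_nonneg[of y] D_nonneg[of "M y"] by simp
  then show thesis by (rule that[OF zero_less_one])
next
  case False
  have cont: "continuous_on UNIV M" "continuous_on UNIV T"
    by (auto intro: linear_continuous_on bounded_linear_M bounded_linear_T)
  have "continuous_on (sphere 0 1 \<inter> S) (\<lambda>y. D y + D (M y))"
    unfolding D_def
    by (intro continuous_intros continuous_on_compose2[OF cont(1)]
        continuous_on_compose2[OF cont(2)]) auto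
  moreover have "compact (sphere 0 1 \<inter> S)"
    using closed_S by (simp add: compact_Int_closed)
  ultimately obtain u where u: "u \<in> sphere 0 1 \<inter> S"
    and min: "\<And>y. y \<in> sphere 0 1 \<inter> S \<Longrightarrow> D u + D (M u) \<le> D y + D (M y)"
    using continuous_attains_inf[OF _ False] by blast
  show thesis
  proof
    have "D u + D (M u) \<noteq> 0"
    proof
      assume "D u + D (M u) = 0"
      then have "D u = 0" "D (M u) = 0"
        using D_nonneg[of u] D_nonneg[of "M u"] by linarith+
      then have "M u = 0" using detectable[of u] by (simp add: D_def)
      \<comment> \<open>\<open>u\<close> lies in the kernel and in its energy complement, hence is
        orthogonal to itself.\<close>
      then have "T u \<bullet> T u = 0" using u by (simp add: S_def)
      then show False using norm_le_T[of u] u by simp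
    qed
    then show "D u + D (M u) > 0"
      using D_nonneg[of u] D_nonneg[of "M u"] by linarith
  next
    fix y assume "y \<in> S"
    show "(D u + D (M u)) * (norm y)\<^sup>2 \<le> D y + D (M y)"
    proof (cases "y = 0")
      case True
      then show ?thesis using D_nonneg[of y] D_nonneg[of "M y"] by simp
    next
      case False
      define w where "w = y /\<^sub>R norm y"
      have y: "y = norm y *\<^sub>R w" using False by (simp add: w_def)
      have "w \<in> sphere 0 1 \<inter> S"
        using \<open>y \<in> S\<close> False by (simp add: w_def S_def linear_cmul[OF linear_T])
      from min[OF this] have "(D u + D (M u)) * (norm y)\<^sup>2 \<le> (D w + D (M w)) * (norm y)\<^sup>2"
        by (intro mult_right_mono) auto
      also have "\<dots> = D (norm y *\<^sub>R w) + D (M (norm y *\<^sub>R w))"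
        by (simp add: D_def linear_cmul[OF linear_M] linear_cmul[OF linear_T]
            power2_eq_square algebra_simps)
      finally show ?thesis using y by simp
    qed
  qed
qed

text \<open>Since \<open>D\<close> is only semidefinite, the Lyapunov function \<open>\<bar>T y\<bar>\<^sup>2 / 2\<close> is corrected by a small
  multiple of \<open>polar y (M y)\<close>, whose derivative contributes the missing term \<open>D (M y)\<close>.\<close>

lemma exponential_decay:
  assumes deriv: "\<And>t. t \<ge> 0 \<Longrightarrow> (y has_vector_derivative M (y t)) (at t within {0..})"
    and in_S: "\<And>t. t \<ge> 0 \<Longrightarrow> y t \<in> S"
  obtains C \<nu> where "C \<ge> 0" "\<nu> > 0" "\<And>t. t \<ge> 0 \<Longrightarrow> norm (y t) \<le> C * exp (- \<nu> * t)"
proof -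
  obtain c where c: "c > 0" "\<And>y. y \<in> S \<Longrightarrow> c * (norm y)\<^sup>2 \<le> D y + D (M y)"
    using coercive by blast
  have lin: "linear (\<lambda>y. M (M y))" "linear (\<lambda>y. M (M (M y)))"
    "linear (\<lambda>y. T (M y))" "linear (\<lambda>y. T (M (M y)))" "linear (\<lambda>y. T (M (M (M y))))"
    using linear_compose[OF linear_M linear_M] linear_compose[OF linear_M linear_T]
      linear_compose[OF linear_compose[OF linear_M linear_M] linear_T]
      linear_compose[OF linear_compose[OF linear_M linear_M] linear_M]
      linear_compose[OF linear_compose[OF linear_compose[OF linear_M linear_M] linear_M] linear_T]
    by (simp_all add: o_def)
  obtain K1 where K1: "K1 > 0" "\<And>y. \<bar>T y \<bullet> T y\<bar> \<le> K1 * (norm y)\<^sup>2"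
    using linear_inner_bound[OF linear_T linear_T] by blast
  obtain K2 where K2: "K2 > 0" "\<And>y. \<bar>T y \<bullet> T (M (M y))\<bar> \<le> K2 * (norm y)\<^sup>2"
    using linear_inner_bound[OF linear_T lin(4)] by blast
  obtain K3 where K3: "K3 > 0" "\<And>y. \<bar>T (M y) \<bullet> T (M y)\<bar> \<le> K3 * (norm y)\<^sup>2"
    using linear_inner_bound[OF lin(3) lin(3)] by blast
  obtain K4 where K4: "K4 > 0" "\<And>y. \<bar>T (M (M y)) \<bullet> T (M (M (M y)))\<bar> \<le> K4 * (norm y)\<^sup>2"
    using linear_inner_bound[OF lin(4) lin(5)] by blast
  define K where "K = K1 + K2 + K3 + K4"
  have K: "K > 0" using K1(1) K2(1) K3(1) K4(1) by (simp add: K_def)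
  have le_K: "k * (norm v)\<^sup>2 \<le> K * (norm v)\<^sup>2" if "k \<in> {K1, K2 + K3, K4}" for k and v :: 's
    using that K1(1) K2(1) K3(1) K4(1) by (intro mult_right_mono) (auto simp: K_def)
  have bT: "(norm (T v))\<^sup>2 \<le> K * (norm v)\<^sup>2" for v
    using K1(2)[of v] le_K[of K1 v] by (simp add: power2_norm_eq_inner)
  have bP: "\<bar>polar v (M v)\<bar> \<le> K * (norm v)\<^sup>2" for v
  proof -
    have "K2 * (norm v)\<^sup>2 + K3 * (norm v)\<^sup>2 \<le> K * (norm v)\<^sup>2"
      using le_K[of "K2 + K3" v] by (simp add: algebra_simps)
    then show ?thesis
      unfolding polar_def using K by (intro abs_half_le[OF K2(2) K3(2)]) auto
  qed
  have bD: "D (M (M v)) \<le> K * (norm v)\<^sup>2" for v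
    using K4(2)[of v] le_K[of K4 v] by (simp add: D_def)
  \<comment> \<open>The bound \<open>1/2\<close> lets \<open>e * D v\<close> be absorbed by
    \<open>D v / 2\<close> and also serves the upper bound on \<open>W\<close>.
    \<open>e * K \<le> c\<close> absorbs the second-order error by coercivity, and
    \<open>e * K \<le> 1/4\<close> keeps \<open>W\<close> positive definite.\<close>
  define e where "e = min (1/2) (min (c / K) (1 / (4 * K)))"
  have e: "e > 0" "e \<le> 1/2" "e * K \<le> c" "e * K \<le> 1/4"
  proof -
    show "e > 0" using c K by (auto simp: e_def)
    show "e \<le> 1/2" unfolding e_def by (rule min.cobounded1)
    have "e \<le> c / K" "e \<le> 1 / (4 * K)" by (auto simp: e_def)
    then show "e * K \<le> c" "e * K \<le> 1/4" using K by (auto simp: field_simps)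
  qed
  define W where "W v = (norm (T v))\<^sup>2 / 2 - e * polar v (M v)" for v
  \<comment> \<open>By bilinearity, \<open>polar v (M v)\<close> has derivative
    \<open>polar (M v) (M v) + polar v (M (M v))\<close> along the flow, and its first term is
    \<open>D (M v)\<close>.\<close>
  define W' where "W' v = - D v - e * (D (M v) + polar v (M (M v)))" for v
  have dW: "((\<lambda>t. W (y t)) has_vector_derivative W' (y t)) (at t within {0..})" if "t \<ge> 0" for t
  proof -
    note d0 = bounded_linear.has_vector_derivative[OF bounded_linear_T deriv[OF that]]
    note dM = bounded_linear.has_vector_derivative[OF bounded_linear_M deriv[OF that]]
    note d1 = bounded_linear.has_vector_derivative[OF bounded_linear_T dM]
    note d2 = bounded_linear.has_vector_derivative[OF bounded_linear_T
        bounded_linear.has_vector_derivative[OF bounded_linear_M dM]]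
    note s = bounded_linear.has_vector_derivative[OF bounded_linear_scaleR_right]
    note i = bounded_bilinear.has_vector_derivative[OF bounded_bilinear_inner]
    have W_eq: "W = (\<lambda>v. (1/2) *\<^sub>R (T v \<bullet> T v) +
        (e/2) *\<^sub>R (T v \<bullet> T (M (M v)) + T (M v) \<bullet> T (M v)))"
      by (simp add: fun_eq_iff W_def polar_def power2_norm_eq_inner field_simps)
    show ?thesis
      unfolding W_eq
      by (rule has_vector_derivative_eq_rhs[OF has_vector_derivative_add
            [OF s[OF i[OF d0 d0]] s[OF has_vector_derivative_add[OF i[OF d0 d2] i[OF d1 d1]]]]])
        (simp add: W'_def D_def polar_def inner_commute field_simps)
  qed
  \<comment> \<open>The quotient of the dissipation bound \<open>e * c / 2\<close> and the upper
    bound \<open>K\<close> for \<open>W\<close>, both relative to the squared norm.\<close>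
  define \<nu> where "\<nu> = e * c / (2 * K)"
  have \<nu>: "\<nu> > 0" using e c K by (simp add: \<nu>_def)
  have W_lower: "(norm v)\<^sup>2 / 4 \<le> W v" for v
  proof -
    have "(norm v)\<^sup>2 \<le> (norm (T v))\<^sup>2" by (intro power_mono norm_le_T) simp
    moreover have "e * polar v (M v) \<le> (norm v)\<^sup>2 / 4"
    proof -
      have "e * polar v (M v) \<le> e * (K * (norm v)\<^sup>2)"
        using bP[of v] e(1) by (intro mult_left_mono) auto
      also have "\<dots> \<le> 1/4 * (norm v)\<^sup>2"
        unfolding mult.assoc[symmetric] by (intro mult_right_mono e(4)) simp
      finally show ?thesis by simp
    qed
    ultimately show ?thesis unfolding W_def by linarith
  qed
  have W_upper: "W v \<le> K * (norm v)\<^sup>2" for v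
  proof -
    have "- e * polar v (M v) \<le> e * (K * (norm v)\<^sup>2)"
    proof -
      have "e * (- polar v (M v)) \<le> e * (K * (norm v)\<^sup>2)"
        using bP[of v] e(1) by (intro mult_left_mono) auto
      then show ?thesis by simp
    qed
    also have "\<dots> \<le> 1/2 * (K * (norm v)\<^sup>2)"
      using e(2) K by (intro mult_right_mono) auto
    finally show ?thesis using bT[of v] unfolding W_def by linarith
  qed
  have W'_bound: "W' v \<le> - \<nu> * W v" if "v \<in> S" for v
  proof -
    \<comment> \<open>Young's inequality for the semidefinite form \<open>D\<close>: nonnegativity
      at \<open>v + e *\<^sub>R M (M v)\<close> controls the mixed term, whose sign is
      unknown.\<close>
    have "0 \<le> D v + 2 * e * polar v (M (M v)) + e\<^sup>2 * D (M (M v))"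
      using D_nonneg[of "v + e *\<^sub>R M (M v)"] by (simp add: D_add_scaleR)
    then have 1: "- (e * polar v (M (M v))) \<le> D v / 2 + e\<^sup>2 * D (M (M v)) / 2"
      by simp
    have 2: "e\<^sup>2 * D (M (M v)) \<le> e * c * (norm v)\<^sup>2"
    proof -
      have "e\<^sup>2 * D (M (M v)) \<le> e\<^sup>2 * (K * (norm v)\<^sup>2)"
        by (intro mult_left_mono bD) simp
      also have "\<dots> = e * ((e * K) * (norm v)\<^sup>2)" by (simp add: power2_eq_square)
      also have "\<dots> \<le> e * (c * (norm v)\<^sup>2)"
        using e by (intro mult_left_mono mult_right_mono) auto
      finally show ?thesis by simp
    qed
    have 3: "e * D v \<le> D v / 2"
      using mult_right_mono[OF e(2) D_nonneg[of v]] by simp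
    have 4: "e * (c * (norm v)\<^sup>2) \<le> e * (D v + D (M v))"
      using c(2)[OF that] e(1) by (intro mult_left_mono) auto
    have "W' v \<le> - (e * c * (norm v)\<^sup>2) / 2"
      using 1 2 3 4 unfolding W'_def distrib_left mult.assoc by linarith
    also have "\<dots> = - \<nu> * (K * (norm v)\<^sup>2)"
      using K by (simp add: \<nu>_def field_simps)
    also have "\<dots> \<le> - \<nu> * W v"
      using W_upper[of v] \<nu> by (simp add: mult_left_mono)
    finally show ?thesis .
  qed
  have decay: "W (y t) * exp (\<nu> * t) \<le> W (y 0)" if "t \<ge> 0" for t
  proof -
    define g' where "g' t = W (y t) * (\<nu> * exp (\<nu> * t)) + W' (y t) * exp (\<nu> * t)" for t
    have "W (y t) * exp (\<nu> * t) \<le> W (y 0) * exp (\<nu> * 0)"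
    proof (rule nonincreasing_from_derivative[of "\<lambda>t. W (y t) * exp (\<nu> * t)" g'])
      show "(0::real) \<le> 0" "0 \<le> t" using that by simp_all
      fix s :: real assume s: "s \<ge> 0"
      have "((\<lambda>t. exp (\<nu> * t)) has_real_derivative \<nu> * exp (\<nu> * s)) (at s within {0..})"
        by (auto intro!: derivative_eq_intros)
      then have "((\<lambda>t. exp (\<nu> * t)) has_vector_derivative \<nu> * exp (\<nu> * s)) (at s within {0..})"
        by (simp add: has_real_derivative_iff_has_vector_derivative)
      from bounded_bilinear.has_vector_derivative[OF bounded_bilinear_mult dW[OF s] this]
      show "((\<lambda>t. W (y t) * exp (\<nu> * t)) has_vector_derivative g' s) (at s within {0..})"
        by (simp add: g'_def)
      have "g' s = (\<nu> * W (y s) + W' (y s)) * exp (\<nu> * s)"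
        by (simp add: g'_def algebra_simps)
      also have "\<dots> \<le> 0"
        using W'_bound[OF in_S[OF s]] by (intro mult_nonpos_nonneg) auto
      finally show "g' s \<le> 0" .
    qed
    then show ?thesis by simp
  qed
  have W0: "W (y 0) \<ge> 0" using W_lower[of "y 0"] zero_le_power2[of "norm (y 0)"] by linarith
  \<comment> \<open>The factor 2 comes from the constant \<open>1/4\<close> in
    \<open>W_lower\<close>; taking the square root halves the rate.\<close>
  have "norm (y t) \<le> 2 * sqrt (W (y 0)) * exp (- (\<nu> / 2) * t)" if "t \<ge> 0" for t
  proof (rule power2_le_imp_le)
    have "W (y t) \<le> W (y 0) * exp (- \<nu> * t)"
      using decay[OF that] by (simp add: exp_minus field_simps)
    then have "(norm (y t))\<^sup>2 \<le> 4 * (W (y 0) * exp (- \<nu> * t))"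
      using W_lower[of "y t"] by linarith
    also have "\<dots> = (2 * sqrt (W (y 0)) * exp (- (\<nu> / 2) * t))\<^sup>2"
    proof -
      have "exp (- \<nu> * t) = (exp (- (\<nu> / 2) * t))\<^sup>2"
        using exp_double[of "- (\<nu> / 2) * t"] by simp
      then show ?thesis using W0 by (simp only: power_mult_distrib) simp
    qed
    finally show "(norm (y t))\<^sup>2 \<le> (2 * sqrt (W (y 0)) * exp (- (\<nu> / 2) * t))\<^sup>2" .
    show "0 \<le> 2 * sqrt (W (y 0)) * exp (- (\<nu> / 2) * t)" using W0 by simp
  qed
  then show thesis using that[of "2 * sqrt (W (y 0))" "\<nu> / 2"] W0 \<nu> by simp
qed

text \<open>The velocity solves the homogeneous system inside \<open>S\<close>, so it decays
  exponentially and \<open>x\<close> has a limit. The limit is an equilibrium because the velocity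
  tends both to 0 and to the field at the limit.\<close>

lemma trajectory_converges:
  assumes "is_trajectory (\<lambda>x. M x + b) x"
  obtains z where "M z + b = 0" "converges_exponentially x z"
proof -
  define y where "y t = M (x t) + b" for t
  have dx: "(x has_vector_derivative y t) (at t within {0..})" if "t \<ge> 0" for t
    using assms that by (simp add: is_trajectory_def y_def)
  have dy: "(y has_vector_derivative M (y t)) (at t within {0..})" if "t \<ge> 0" for t
    using bounded_linear.has_vector_derivative[OF bounded_linear_M dx[OF that]]
    unfolding y_def by (simp add: has_vector_derivative_add_const)
  obtain C \<nu> where C: "C \<ge> 0" "\<nu> > 0" "\<And>t. t \<ge> 0 \<Longrightarrow> norm (y t) \<le> C * exp (- \<nu> * t)"
    using exponential_decay[OF dy] field_in_S unfolding y_def by blast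
  obtain z where z: "\<And>t. t \<ge> 0 \<Longrightarrow> dist (x t) z \<le> C / \<nu> * exp (- \<nu> * t)"
    and lim: "(\<lambda>n. x (real n)) \<longlonglongrightarrow> z"
    using exponentially_decaying_velocity_imp_convergence[OF dx C(3) C(1,2)] by blast
  have "(\<lambda>n. y (real n)) \<longlonglongrightarrow> M z + b"
    unfolding y_def by (intro tendsto_intros bounded_linear.tendsto[OF bounded_linear_M] lim)
  moreover have "(\<lambda>n. y (real n)) \<longlonglongrightarrow> 0"
  proof (rule Lim_null_comparison)
    show "\<forall>\<^sub>F n in sequentially. norm (y (real n)) \<le> C * exp (- \<nu> * real n)"
      using C(3) by simp
    show "(\<lambda>n. C * exp (- \<nu> * real n)) \<longlonglongrightarrow> 0" by (rule exp_neg_tendsto_0) fact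
  qed
  ultimately have "M z + b = 0" by (rule LIMSEQ_unique)
  moreover have "converges_exponentially x z"
    using z C(1,2) unfolding converges_exponentially_def
    by (intro exI[of _ "C / \<nu>"] exI[of _ \<nu>] conjI) auto
  ultimately show thesis using that by blast
qed

text \<open>The energy of the deviation from \<open>z\<close> never increases. It dominates the norm
  and is at most \<open>K\<close> times the norm, so the radius \<open>\<epsilon> / K\<close>
  suffices.\<close>

lemma equilibrium_lyapunov_stable:
  assumes "M z + b = 0"
  shows "lyapunov_stable (\<lambda>x. M x + b) z"
proof -
  obtain K where K: "K > 0" "\<And>y. norm (T y) \<le> K * norm y"
    using linear_bounded_pos[OF linear_T] by blast
  have bound: "norm (x t - z) \<le> K * norm (x 0 - z)"
    if "is_trajectory (\<lambda>x. M x + b) x" "t \<ge> 0" for x t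
  proof -
    define y where "y t = x t - z" for t
    have M_y: "M (x s) + b = M (y s)" for s
      using assms by (simp add: y_def linear_diff[OF linear_M] eq_diff_eq add.commute)
    have dy: "(y has_vector_derivative M (y s)) (at s within {0..})" if "s \<ge> 0" for s
    proof -
      have "(x has_vector_derivative M (y s)) (at s within {0..})"
        using \<open>is_trajectory _ x\<close> that by (simp add: is_trajectory_def M_y)
      from has_vector_derivative_diff[OF this has_vector_derivative_const[of z]]
      show ?thesis unfolding y_def by simp
    qed
    have "T (y t) \<bullet> T (y t) \<le> T (y 0) \<bullet> T (y 0)"
    proof (rule nonincreasing_from_derivative[of "\<lambda>t. T (y t) \<bullet> T (y t)"
          "\<lambda>t. 2 * (T (y t) \<bullet> T (M (y t)))"])
      show "(0::real) \<le> 0" "0 \<le> t" using \<open>t \<ge> 0\<close> by simp_all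
      fix s :: real assume "s \<ge> 0"
      note d = bounded_linear.has_vector_derivative[OF bounded_linear_T dy[OF this]]
      show "((\<lambda>t. T (y t) \<bullet> T (y t)) has_vector_derivative 2 * (T (y s) \<bullet> T (M (y s))))
          (at s within {0..})"
        by (rule has_vector_derivative_eq_rhs
            [OF bounded_bilinear.has_vector_derivative[OF bounded_bilinear_inner d d]])
          (simp add: inner_commute)
      show "2 * (T (y s) \<bullet> T (M (y s))) \<le> 0" using dissipative[of "y s"] by simp
    qed
    then have "norm (T (y t)) \<le> norm (T (y 0))" by (simp add: norm_le)
    then show ?thesis using K(2)[of "y 0"] norm_le_T[of "y t"] by (simp add: y_def)
  qed
  show ?thesis
    unfolding lyapunov_stable_def
  proof (intro allI impI)
    fix \<epsilon> :: real assume "\<epsilon> > 0"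
    show "\<exists>\<delta>>0. \<forall>x. is_trajectory (\<lambda>x. M x + b) x \<longrightarrow> x 0 \<in> ball z \<delta> \<longrightarrow>
        (\<forall>t\<ge>0. x t \<in> ball z \<epsilon>)"
    proof (intro exI[of _ "\<epsilon> / K"] conjI allI impI)
      show "\<epsilon> / K > 0" using \<open>\<epsilon> > 0\<close> K by simp
      fix x t assume x: "is_trajectory (\<lambda>x. M x + b) x" "x 0 \<in> ball z (\<epsilon> / K)" "(t::real) \<ge> 0"
      have "K * norm (x 0 - z) < \<epsilon>"
        using x(2) K(1) by (simp add: dist_norm norm_minus_commute field_simps)
      then show "x t \<in> ball z \<epsilon>"
        using bound[OF x(1,3)] by (simp add: dist_norm norm_minus_commute)
    qed
  qed
qed

end

section \<open>The stacked operators of the system and their adjoints\<close>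

text \<open>Collecting all agents into one vector turns the field into combinations of linear maps
  that come in adjoint pairs, so cross terms in the energy cancel by moving a map across the inner
  product.\<close>

definition laplacian :: "real ^ 'n ^ 'n \<Rightarrow> ('v::real_vector) ^ 'n \<Rightarrow> 'v ^ ('n::finite)" where
  "laplacian a V = (\<chi> i. coupling a V i)"

definition block_mults ::
  "('k::finite \<Rightarrow> 'n) \<Rightarrow> real ^ 'k ^ 'c \<Rightarrow> real ^ 'd ^ 'k \<Rightarrow> real ^ 'd ^ 'c ^ 'n" where
  "block_mults \<rho> A Y = (\<chi> i. block_mult \<rho> i A Y)"

definition block_mults_adjoint ::
  "('k \<Rightarrow> 'n) \<Rightarrow> real ^ 'k ^ 'c \<Rightarrow> real ^ 'd ^ 'c ^ 'n \<Rightarrow> real ^ 'd ^ ('k::finite)" where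
  "block_mults_adjoint \<rho> A N = (\<chi> k. (transpose A ** N $ \<rho> k) $ k)"

definition row_augs :: "('k \<Rightarrow> 'n) \<Rightarrow> real ^ 'c ^ 'k \<Rightarrow> real ^ 'c ^ 'k ^ 'n" where
  "row_augs \<rho> Y = (\<chi> i. row_aug \<rho> i Y)"

text \<open>Each agent's copy contributes only the rows of its own block: this stacks the products
  \<open>[I]_C\<close> with the copy of agent \<open>i\<close>.\<close>

definition row_augs_adjoint :: "('k \<Rightarrow> 'n) \<Rightarrow> real ^ 'c ^ 'k ^ 'n \<Rightarrow> real ^ 'c ^ 'k" where
  "row_augs_adjoint \<rho> L = (\<chi> k. L $ \<rho> k $ k)"

definition col_mults ::
  "('q \<Rightarrow> 'n) \<Rightarrow> real ^ 'q ^ 'p \<Rightarrow> real ^ 'p ^ 'r ^ 'n \<Rightarrow> real ^ 'q ^ ('r::finite) ^ 'n" where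
  "col_mults \<kappa> B X = (\<chi> i. X $ i ** col_aug \<kappa> i B)"

definition col_mults_adjoint ::
  "('q \<Rightarrow> 'n) \<Rightarrow> real ^ 'q ^ 'p \<Rightarrow> real ^ 'q ^ 'r ^ 'n \<Rightarrow> real ^ 'p ^ ('r::finite) ^ 'n" where
  "col_mults_adjoint \<kappa> B L = (\<chi> i. L $ i ** transpose (col_aug \<kappa> i B))"

lemmas stacked_defs = laplacian_def block_mults_def block_mults_adjoint_def row_augs_def
  row_augs_adjoint_def col_mults_def col_mults_adjoint_def

section \<open>Linearity of the stacked operators\<close>

lemma linear_laplacian: "linear (laplacian a)"
  by (rule linearI) (simp_all add: vec_eq_iff laplacian_def coupling_def algebra_simps
      sum.distrib sum_subtractf scaleR_sum_right)

lemma linear_block_mults: "linear (block_mults \<rho> A)"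
  by (rule linearI) (simp_all add: vec_eq_iff block_mults_def block_mult_def algebra_simps
      sum.distrib sum_distrib_left)

lemma linear_block_mults_adjoint: "linear (block_mults_adjoint \<rho> A)"
  by (rule linearI) (simp_all add: vec_eq_iff block_mults_adjoint_def matrix_matrix_mult_def
      algebra_simps sum.distrib sum_distrib_left)

lemma linear_row_augs: "linear (row_augs \<rho>)"
  by (rule linearI) (simp_all add: vec_eq_iff row_augs_def row_aug_def)

lemma linear_row_augs_adjoint: "linear (row_augs_adjoint \<rho>)"
  by (rule linearI) (simp_all add: vec_eq_iff row_augs_adjoint_def)

lemma linear_col_mults: "linear (col_mults \<kappa> B)"
  by (rule linearI) (simp_all add: vec_eq_iff col_mults_def matrix_matrix_mult_def
      algebra_simps sum.distrib sum_distrib_left)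

lemma linear_col_mults_adjoint: "linear (col_mults_adjoint \<kappa> B)"
  by (rule linearI) (simp_all add: vec_eq_iff col_mults_adjoint_def matrix_matrix_mult_def
      algebra_simps sum.distrib sum_distrib_left)

lemmas linear_stacked = linear_laplacian linear_block_mults linear_block_mults_adjoint
  linear_row_augs linear_row_augs_adjoint linear_col_mults linear_col_mults_adjoint

section \<open>Adjoint identities\<close>

lemma inner_matrix_mult_left:
  fixes A :: "real ^ 'k ^ 'm" and Y :: "real ^ 'q ^ 'k"
  shows "(A ** Y) \<bullet> N = Y \<bullet> (transpose A ** N)"
proof -
  have "(A ** Y) \<bullet> N = (\<Sum>m\<in>UNIV. \<Sum>q\<in>UNIV. \<Sum>k\<in>UNIV. A $ m $ k * Y $ k $ q * N $ m $ q)"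
    by (simp add: inner_vec_def matrix_matrix_mult_def sum_distrib_right)
  also have "\<dots> = (\<Sum>m\<in>UNIV. \<Sum>k\<in>UNIV. \<Sum>q\<in>UNIV. A $ m $ k * Y $ k $ q * N $ m $ q)"
    by (intro sum.cong refl sum.swap)
  also have "\<dots> = (\<Sum>k\<in>UNIV. \<Sum>m\<in>UNIV. \<Sum>q\<in>UNIV. A $ m $ k * Y $ k $ q * N $ m $ q)"
    by (rule sum.swap)
  also have "\<dots> = (\<Sum>k\<in>UNIV. \<Sum>q\<in>UNIV. \<Sum>m\<in>UNIV. A $ m $ k * Y $ k $ q * N $ m $ q)"
    by (intro sum.cong refl sum.swap)
  also have "\<dots> = Y \<bullet> (transpose A ** N)"
    by (simp add: inner_vec_def matrix_matrix_mult_def transpose_def sum_distrib_left mult_ac)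
  finally show ?thesis .
qed

lemma inner_transpose:
  fixes X Y :: "real ^ 'k ^ 'm"
  shows "transpose X \<bullet> transpose Y = X \<bullet> Y"
  unfolding inner_vec_def transpose_def by (simp add: inner_vec_def) (rule sum.swap)

lemma inner_matrix_mult_right:
  fixes X :: "real ^ 'p ^ 'r" and B :: "real ^ 'q ^ 'p"
  shows "(X ** B) \<bullet> L = X \<bullet> (L ** transpose B)"
proof -
  have "(X ** B) \<bullet> L = (transpose B ** transpose X) \<bullet> transpose L"
    by (simp add: inner_transpose flip: matrix_transpose_mul)
  also have "\<dots> = transpose X \<bullet> transpose (L ** transpose B)"
    by (simp add: inner_matrix_mult_left matrix_transpose_mul)
  finally show ?thesis by (simp add: inner_transpose)
qed

lemma inner_col_mults: "col_mults \<kappa> B X \<bullet> L = X \<bullet> col_mults_adjoint \<kappa> B L"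
  by (subst (1 2) inner_vec_def)
    (simp add: col_mults_def col_mults_adjoint_def inner_matrix_mult_right)

lemma inner_row_augs:
  fixes Y :: "real ^ 'c ^ 'k" and \<rho> :: "'k \<Rightarrow> 'n::finite"
  shows "row_augs \<rho> Y \<bullet> L = Y \<bullet> row_augs_adjoint \<rho> L"
proof -
  have "row_augs \<rho> Y \<bullet> L
      = (\<Sum>i\<in>UNIV. \<Sum>k\<in>UNIV. if \<rho> k = i then \<Sum>c\<in>UNIV. Y $ k $ c * L $ i $ k $ c else 0)"
    by (auto simp: inner_vec_def row_augs_def row_aug_def intro!: sum.cong)
  also have "\<dots> = (\<Sum>k\<in>UNIV. \<Sum>i\<in>UNIV. if \<rho> k = i then \<Sum>c\<in>UNIV. Y $ k $ c * L $ i $ k $ c else 0)"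
    by (rule sum.swap)
  also have "\<dots> = Y \<bullet> row_augs_adjoint \<rho> L"
    by (simp add: inner_vec_def row_augs_adjoint_def)
  finally show ?thesis .
qed

text \<open>Zero padding replaces a block product by an ordinary matrix product, so its adjoint
  follows from those of padding and of multiplication by \<open>A\<close>.\<close>

lemma block_mult_eq: "block_mult \<rho> i A Y = A ** row_aug \<rho> i Y"
  by (simp add: vec_eq_iff block_mult_def row_aug_def matrix_matrix_mult_def
      if_distrib[of "(*) _"] sum.If_cases Int_def cong: if_cong)

lemma inner_block_mults: "block_mults \<rho> A Y \<bullet> N = Y \<bullet> block_mults_adjoint \<rho> A N"
proof -
  have "block_mults \<rho> A Y \<bullet> N = (\<Sum>i\<in>UNIV. row_aug \<rho> i Y \<bullet> (transpose A ** N $ i))"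
    by (subst inner_vec_def) (simp add: block_mults_def block_mult_eq inner_matrix_mult_left)
  also have "\<dots> = row_augs \<rho> Y \<bullet> (\<chi> i. transpose A ** N $ i)"
    by (subst (2) inner_vec_def) (simp add: row_augs_def)
  also have "\<dots> = Y \<bullet> block_mults_adjoint \<rho> A N"
    by (simp add: inner_row_augs row_augs_adjoint_def block_mults_adjoint_def)
  finally show ?thesis .
qed

section \<open>Block sums and the weighted graph Laplacian\<close>

lemma sum_row_aug:
  fixes \<rho> :: "'k::finite \<Rightarrow> 'n::finite"
  shows "(\<Sum>i\<in>UNIV. row_aug \<rho> i Y) = Y"
  by (simp add: vec_eq_iff row_aug_def)

lemma sum_col_aug:
  fixes \<kappa> :: "'k::finite \<Rightarrow> 'n::finite"
  shows "(\<Sum>i\<in>UNIV. col_aug \<kappa> i B) = B"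
  by (simp add: vec_eq_iff col_aug_def)

lemma matrix_mult_sum_right:
  fixes A :: "real ^ 'k ^ 'm"
  shows "(\<Sum>i\<in>I. A ** G i) = A ** (\<Sum>i\<in>I. G i)"
  by (induction I rule: infinite_finite_induct) (simp_all add: matrix_add_ldistrib)

text \<open>Symmetry of the weights allows exchanging the two indices; averaging the sum with its
  exchanged form completes the difference in the first argument.\<close>

lemma inner_laplacian:
  fixes V W :: "('v::real_inner) ^ 'n::finite"
  assumes "\<And>i j. a $ i $ j = a $ j $ i"
  shows "V \<bullet> laplacian a W
    = (\<Sum>i\<in>UNIV. \<Sum>j\<in>UNIV. a $ i $ j * ((V $ i - V $ j) \<bullet> (W $ i - W $ j))) / 2"
proof -
  define S1 where "S1 = (\<Sum>i\<in>UNIV. \<Sum>j\<in>UNIV. a $ i $ j * (V $ i \<bullet> (W $ i - W $ j)))"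
  have "S1 = (\<Sum>i\<in>UNIV. \<Sum>j\<in>UNIV. a $ j $ i * (V $ j \<bullet> (W $ j - W $ i)))"
    unfolding S1_def by (rule sum.swap)
  also have "\<dots> = (\<Sum>i\<in>UNIV. \<Sum>j\<in>UNIV. a $ i $ j * (- V $ j \<bullet> (W $ i - W $ j)))"
    by (intro sum.cong refl) (simp add: assms inner_diff_right)
  finally have "S1 + S1
      = (\<Sum>i\<in>UNIV. \<Sum>j\<in>UNIV. a $ i $ j * ((V $ i - V $ j) \<bullet> (W $ i - W $ j)))"
    by (subst (1) S1_def) (simp add: inner_diff_left algebra_simps flip: sum.distrib)
  moreover have "V \<bullet> laplacian a W = S1"
    by (simp add: S1_def inner_vec_def laplacian_def coupling_def inner_sum_right)
  ultimately show ?thesis by simp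
qed

lemma laplacian_self_adjoint:
  fixes V W :: "('v::real_inner) ^ 'n::finite"
  assumes "\<And>i j. a $ i $ j = a $ j $ i"
  shows "V \<bullet> laplacian a W = laplacian a V \<bullet> W"
  by (subst (2) inner_commute) (simp add: inner_laplacian[OF assms] inner_commute)

lemma laplacian_nonneg:
  fixes V :: "('v::real_inner) ^ 'n::finite"
  assumes "\<And>i j. a $ i $ j = a $ j $ i" "\<And>i j. a $ i $ j \<ge> 0"
  shows "V \<bullet> laplacian a V \<ge> 0"
  using assms(2) by (simp add: inner_laplacian[OF assms(1)] sum_nonneg)

text \<open>Each summand is antisymmetric in the two agents, so exchanging the indices shows that
  the sum equals its own negative.\<close>

lemma sum_coupling:
  fixes V :: "('v::real_inner) ^ 'n::finite"
  assumes "\<And>i j. a $ i $ j = a $ j $ i"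
  shows "(\<Sum>i\<in>UNIV. coupling a V i) = 0"
proof -
  have "(\<Sum>i\<in>UNIV. coupling a V i) = (\<Sum>i\<in>UNIV. \<Sum>j\<in>UNIV. a $ j $ i *\<^sub>R (V $ j - V $ i))"
    unfolding coupling_def by (rule sum.swap)
  also have "\<dots> = - (\<Sum>i\<in>UNIV. coupling a V i)"
    unfolding coupling_def sum_negf[symmetric]
    by (intro sum.cong refl) (simp add: assms flip: scaleR_minus_right)
  finally show ?thesis by (simp add: eq_neg_iff_add_eq_0 flip: scaleR_2)
qed

lemma weighted_adjacencyD:
  assumes "weighted_adjacency E a"
  shows "a $ i $ j = a $ j $ i" "a $ i $ j \<ge> 0" "{i, j} \<in> E \<Longrightarrow> a $ i $ j > 0"
  using assms unfolding weighted_adjacency_def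
  by (metis, metis less_eq_real_def, metis insert_commute)

text \<open>A vanishing sum of nonnegative terms vanishes termwise, so values agree across every
  edge; paths in the connected graph carry the agreement to all pairs.\<close>

lemma laplacian_inner_eq_0D:
  fixes V :: "('v::real_inner) ^ 'n::finite"
  assumes adj: "weighted_adjacency E a" and conn: "graph_connected E"
    and zero: "V \<bullet> laplacian a V = 0"
  shows "V $ i = V $ j" and "laplacian a V = 0"
proof -
  note a = weighted_adjacencyD[OF adj]
  have nonneg: "0 \<le> a $ i $ j * ((V $ i - V $ j) \<bullet> (V $ i - V $ j))" for i j
    using a(2) by simp
  have "(\<Sum>i\<in>UNIV. \<Sum>j\<in>UNIV. a $ i $ j * ((V $ i - V $ j) \<bullet> (V $ i - V $ j))) = 0"
    using zero by (simp add: inner_laplacian[OF a(1)])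
  then have "a $ i $ j * ((V $ i - V $ j) \<bullet> (V $ i - V $ j)) = 0" for i j
    using nonneg by (simp add: sum_nonneg_eq_0_iff sum_nonneg)
  then have edge: "V $ i = V $ j" if "{i, j} \<in> E" for i j
    using a(3)[OF that] by (metis inner_eq_zero_iff mult_eq_0_iff order_less_irrefl right_minus_eq)
  have consensus: "V $ i = V $ j" for i j
  proof -
    have "(i, j) \<in> {(u, v). {u, v} \<in> E}\<^sup>*" using conn by (simp add: graph_connected_def)
    then show ?thesis by induction (auto dest: edge)
  qed
  show "V $ i = V $ j" by (rule consensus)
  have "a $ i $ j *\<^sub>R (V $ i - V $ j) = 0" for i j using consensus[of i j] by simp
  then have "coupling a V i = 0" for i unfolding coupling_def by (intro sum.neutral ballI)
  then show "laplacian a V = 0" by (simp add: vec_eq_iff laplacian_def)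
qed

section \<open>Dissipation along the system\<close>

lemma prod_cases8:
  obtains (fields) a b c d e f g h where "s = (a, b, c, d, e, f, g, h)"
  by (metis prod.exhaust_sel)

lemma ccr_field_stacked:
  "ccr_field A B F \<rho> \<kappa> \<mu> a (X, Y, U, W, Z, L1, L2, L3) =
    (let e = block_mults \<rho> A Y - row_augs \<mu> F - U;
         Ydot = - block_mults_adjoint \<rho> A e - row_augs_adjoint \<rho> L3;
         Udot = e - L2
     in (col_mults_adjoint \<kappa> B L3 - laplacian a L1 - laplacian a X, Ydot, Udot,
         laplacian a L2, laplacian a L3, laplacian a X,
         U + Udot - laplacian a W - laplacian a L2,
         row_augs \<rho> Y + row_augs \<rho> Ydot - col_mults \<kappa> B X - laplacian a Z - laplacian a L3))"
proof -
  have "(\<chi> k. - ((transpose A ** (block_mult \<rho> (\<rho> k) A Y - row_aug \<mu> (\<rho> k) F - U $ \<rho> k)) $ k)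
      - L3 $ \<rho> k $ k)
    = - block_mults_adjoint \<rho> A (block_mults \<rho> A Y - row_augs \<mu> F - U) - row_augs_adjoint \<rho> L3"
    by (simp add: vec_eq_iff stacked_defs)
  then show ?thesis
    by (simp add: ccr_field_def Let_def) (simp add: vec_eq_iff stacked_defs)
qed

text \<open>The norm of \<open>residual_graph A \<rho> s\<close> is the energy norm of \<open>s\<close>.\<close>

definition residual_graph ::
  "real ^ 'r ^ 'm \<Rightarrow> ('r \<Rightarrow> 'n) \<Rightarrow> ('m::finite, 'r::finite, 'p::finite, 'q::finite, 'n::finite) state \<Rightarrow>
   ('m, 'r, 'p, 'q, 'n) state \<times> (real ^ 'q ^ 'm ^ 'n)" where
  "residual_graph A \<rho> s = (s, block_mults \<rho> A (fst (snd s)) - fst (snd (snd s)))"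

lemma linear_residual_graph: "linear (residual_graph A \<rho>)"
  by (rule linearI)
    (simp_all add: residual_graph_def linear_add[OF linear_block_mults]
      linear_cmul[OF linear_block_mults] algebra_simps)

lemma ccr_field_affine:
  "ccr_field A B F \<rho> \<kappa> \<mu> a s = ccr_field A B 0 \<rho> \<kappa> \<mu> a s + ccr_field A B F \<rho> \<kappa> \<mu> a 0"
proof (cases s rule: prod_cases8)
  case (fields X Y U W Z L1 L2 L3)
  note lin = linear_0[OF linear_block_mults] linear_0[OF linear_row_augs]
    linear_0[OF linear_laplacian] linear_0[OF linear_row_augs_adjoint]
    linear_0[OF linear_col_mults] linear_0[OF linear_col_mults_adjoint]
    linear_diff[OF linear_block_mults_adjoint] linear_diff[OF linear_row_augs]
    linear_neg[OF linear_block_mults_adjoint] linear_neg[OF linear_row_augs]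
    linear_0[OF linear_block_mults_adjoint]
    linear_add[OF linear_block_mults_adjoint] linear_add[OF linear_row_augs]
  show ?thesis
    unfolding fields zero_prod_def ccr_field_stacked Let_def by (simp add: lin algebra_simps)
qed

lemma linear_ccr_field:
  fixes A :: "real ^ 'r::finite ^ 'm::finite" and B :: "real ^ 'q::finite ^ 'p::finite"
    and a :: "real ^ 'n ^ 'n::finite"
  shows "linear (ccr_field A B 0 \<rho> \<kappa> \<mu> a)"
proof -
  note lin = linear_0[OF linear_row_augs]
    linear_stacked[THEN linear_add] linear_stacked[THEN linear_diff] linear_stacked[THEN linear_neg]
    linear_stacked[THEN linear_cmul]
  show ?thesis
  proof (rule linearI)
    fix s t :: "('m, 'r, 'p, 'q, 'n) state"
    obtain X Y U W Z L1 L2 L3 where s: "s = (X, Y, U, W, Z, L1, L2, L3)"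
      by (cases s rule: prod_cases8)
    obtain X' Y' U' W' Z' L1' L2' L3' where t: "t = (X', Y', U', W', Z', L1', L2', L3')"
      by (cases t rule: prod_cases8)
    show "ccr_field A B 0 \<rho> \<kappa> \<mu> a (s + t)
        = ccr_field A B 0 \<rho> \<kappa> \<mu> a s + ccr_field A B 0 \<rho> \<kappa> \<mu> a t"
      unfolding s t add_Pair ccr_field_stacked Let_def by (simp add: lin algebra_simps)
    show "ccr_field A B 0 \<rho> \<kappa> \<mu> a (c *\<^sub>R s) = c *\<^sub>R ccr_field A B 0 \<rho> \<kappa> \<mu> a s" for c
      unfolding s scaleR_Pair ccr_field_stacked Let_def by (simp add: lin algebra_simps)
  qed
qed

text \<open>Adjoint pairs cancel all skew couplings. The extra energy term contributes
  \<open>e \<bullet> block_mults \<rho> A Ydot - e \<bullet> Udot\<close>, which together with the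
  derivative feedback in the last two equations forms the squares of \<open>Ydot\<close> and
  \<open>Udot\<close> with negative sign.\<close>

lemma dissipation:
  fixes A :: "real ^ 'r::finite ^ 'm::finite" and B :: "real ^ 'q::finite ^ 'p::finite"
    and a :: "real ^ 'n ^ 'n::finite"
  assumes sym: "\<And>i j. a $ i $ j = a $ j $ i"
    and e: "e = block_mults \<rho> A Y - U"
    and Ydot: "Ydot = - block_mults_adjoint \<rho> A e - row_augs_adjoint \<rho> L3"
    and Udot: "Udot = e - L2"
    and s: "s = (X, Y, U, W, Z, L1, L2, L3)"
  shows "residual_graph A \<rho> s \<bullet> residual_graph A \<rho> (ccr_field A B 0 \<rho> \<kappa> \<mu> a s) =
    - (X \<bullet> laplacian a X + e \<bullet> e + L2 \<bullet> laplacian a L2 + L3 \<bullet> laplacian a L3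
       + Ydot \<bullet> Ydot + Udot \<bullet> Udot)"
proof -
  have field: "ccr_field A B 0 \<rho> \<kappa> \<mu> a s =
    (col_mults_adjoint \<kappa> B L3 - laplacian a L1 - laplacian a X, Ydot, Udot,
     laplacian a L2, laplacian a L3, laplacian a X,
     U + Udot - laplacian a W - laplacian a L2,
     row_augs \<rho> Y + row_augs \<rho> Ydot - col_mults \<kappa> B X - laplacian a Z - laplacian a L3)"
    by (simp add: s ccr_field_stacked Let_def Udot Ydot e linear_0[OF linear_row_augs])
  define G where "G = block_mults_adjoint \<rho> A e"
  define R where "R = row_augs_adjoint \<rho> L3"
  have 1: "X \<bullet> col_mults_adjoint \<kappa> B L3 = L3 \<bullet> col_mults \<kappa> B X"
    by (metis inner_col_mults inner_commute)
  have self_adjoint: "V \<bullet> laplacian a V' = V' \<bullet> laplacian a V" for V V' :: "'v::real_inner ^ 'n"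
    by (metis laplacian_self_adjoint[OF sym] inner_commute)
  have 2: "Z \<bullet> laplacian a L3 = L3 \<bullet> laplacian a Z" "W \<bullet> laplacian a L2 = L2 \<bullet> laplacian a W"
    "X \<bullet> laplacian a L1 = L1 \<bullet> laplacian a X"
    by (rule self_adjoint)+
  have 3: "L3 \<bullet> row_augs \<rho> V = V \<bullet> R" for V
    unfolding R_def by (metis inner_row_augs inner_commute)
  have 4: "e \<bullet> block_mults \<rho> A V = V \<bullet> G" for V
    unfolding G_def by (metis inner_block_mults inner_commute)
  \<comment> \<open>Substituting the definition of \<open>e\<close> into one factor of
    \<open>e \<bullet> e\<close> is what produces the term \<open>- (e \<bullet> e)\<close>.\<close>
  have 5: "U \<bullet> e = Y \<bullet> G - e \<bullet> e"
    using 4[of Y] by (simp add: e inner_diff_left inner_diff_right inner_commute)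
  have 6: "Ydot \<bullet> Ydot = - (Ydot \<bullet> G) - Ydot \<bullet> R"
    by (subst (2) Ydot) (simp add: G_def R_def inner_diff_right)
  have 7: "Udot \<bullet> Udot = e \<bullet> Udot - L2 \<bullet> Udot"
    by (subst (1) Udot) (simp add: inner_diff_left)
  have 8: "Y \<bullet> Ydot = - (Y \<bullet> G) - Y \<bullet> R" "U \<bullet> Udot = U \<bullet> e - L2 \<bullet> U"
    by (simp_all add: Ydot Udot G_def R_def inner_diff_right inner_commute)
  have "residual_graph A \<rho> s \<bullet> residual_graph A \<rho> (ccr_field A B 0 \<rho> \<kappa> \<mu> a s) =
     (X \<bullet> col_mults_adjoint \<kappa> B L3 - X \<bullet> laplacian a L1 - X \<bullet> laplacian a X)
     + Y \<bullet> Ydot + U \<bullet> Udot + W \<bullet> laplacian a L2 + Z \<bullet> laplacian a L3 + L1 \<bullet> laplacian a X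
     + (L2 \<bullet> U + L2 \<bullet> Udot - L2 \<bullet> laplacian a W - L2 \<bullet> laplacian a L2)
     + (L3 \<bullet> row_augs \<rho> Y + L3 \<bullet> row_augs \<rho> Ydot - L3 \<bullet> col_mults \<kappa> B X
        - L3 \<bullet> laplacian a Z - L3 \<bullet> laplacian a L3)
     + (e \<bullet> block_mults \<rho> A Ydot - e \<bullet> Udot)"
    unfolding residual_graph_def field
    by (simp add: s flip: e) (simp add: inner_add_right inner_diff_right)
  also have "\<dots> = - (X \<bullet> laplacian a X + e \<bullet> e + L2 \<bullet> laplacian a L2 + L3 \<bullet> laplacian a L3
       + Ydot \<bullet> Ydot + Udot \<bullet> Udot)"
    unfolding 1 2 3 4 8 5 6 7 by simp
  finally show ?thesis .
qed

text \<open>Row \<open>k\<close> is known to vanish only in the copy of agent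
  \<open>\<rho> k\<close>; agreement of the copies spreads this to every agent.\<close>

lemma vec_eq_0_if_consensus:
  fixes L :: "real ^ 'c ^ 'k ^ 'n"
  assumes "\<And>i j. L $ i = L $ j" "row_augs_adjoint \<rho> L = 0"
  shows "L = 0"
proof -
  have "L $ i $ k = L $ \<rho> k $ k" for i k using assms(1)[of i "\<rho> k"] by simp
  moreover have "L $ \<rho> k $ k = 0" for k
    using assms(2) by (simp add: vec_eq_iff row_augs_adjoint_def)
  ultimately show ?thesis by (simp add: vec_eq_iff)
qed

context
  fixes A :: "real ^ 'r::finite ^ 'm::finite" and B :: "real ^ 'q::finite ^ 'p::finite"
    and \<rho> :: "'r \<Rightarrow> 'n::finite" and \<kappa> :: "'q \<Rightarrow> 'n" and \<mu> :: "'m \<Rightarrow> 'n"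
    and E :: "'n set set" and a :: "real ^ 'n ^ 'n"
  assumes adj: "weighted_adjacency E a" and conn: "graph_connected E"
begin

lemma dissipation_nonpos:
  "residual_graph A \<rho> s \<bullet> residual_graph A \<rho> (ccr_field A B 0 \<rho> \<kappa> \<mu> a s) \<le> 0"
proof (cases s rule: prod_cases8)
  case (fields X Y U W Z L1 L2 L3)
  note nonneg = laplacian_nonneg[OF weighted_adjacencyD(1)[OF adj] weighted_adjacencyD(2)[OF adj]]
  show ?thesis
    unfolding dissipation[OF weighted_adjacencyD(1)[OF adj] refl refl refl fields]
    unfolding neg_le_0_iff_le by (intro add_nonneg_nonneg nonneg inner_ge_zero)
qed

text \<open>Every term of the dissipation is nonnegative, so all vanish. With \<open>e = 0\<close>,
  the vanishing of \<open>Udot\<close> leaves \<open>L2 = 0\<close>, and that of \<open>Ydot\<close>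
  leaves zero own-block rows of \<open>L3\<close>; consensus of \<open>L3\<close> then removes the
  rest.\<close>

lemma dissipation_eq_0D:
  assumes "residual_graph A \<rho> s \<bullet> residual_graph A \<rho> (ccr_field A B 0 \<rho> \<kappa> \<mu> a s) = 0"
    and s: "s = (X, Y, U, W, Z, L1, L2, L3)"
  shows "laplacian a X = 0" "block_mults \<rho> A Y - U = 0" "L2 = 0" "L3 = 0"
proof -
  define e where "e = block_mults \<rho> A Y - U"
  define Ydot where "Ydot = - block_mults_adjoint \<rho> A e - row_augs_adjoint \<rho> L3"
  define Udot where "Udot = e - L2"
  note nonneg = laplacian_nonneg[OF weighted_adjacencyD(1)[OF adj] weighted_adjacencyD(2)[OF adj]]
  have "X \<bullet> laplacian a X + e \<bullet> e + L2 \<bullet> laplacian a L2 + L3 \<bullet> laplacian a L3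
       + Ydot \<bullet> Ydot + Udot \<bullet> Udot = 0"
    using dissipation[OF weighted_adjacencyD(1)[OF adj] e_def Ydot_def Udot_def s] assms(1) by simp
  then have zero: "X \<bullet> laplacian a X = 0" "e \<bullet> e = 0" "L3 \<bullet> laplacian a L3 = 0"
      "Ydot \<bullet> Ydot = 0" "Udot \<bullet> Udot = 0"
    using nonneg[of X] nonneg[of L2] nonneg[of L3] inner_ge_zero[of e] inner_ge_zero[of Ydot]
      inner_ge_zero[of Udot] by linarith+
  show "laplacian a X = 0" by (rule laplacian_inner_eq_0D(2)[OF adj conn zero(1)])
  show "block_mults \<rho> A Y - U = 0" using zero(2) by (simp add: e_def)
  show "L2 = 0" using zero(2,5) by (simp add: Udot_def)
  have "row_augs_adjoint \<rho> L3 = 0"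
    using zero(2,4) by (simp add: Ydot_def linear_0[OF linear_block_mults_adjoint])
  then show "L3 = 0"
    using laplacian_inner_eq_0D(1)[OF adj conn zero(3)] vec_eq_0_if_consensus by blast
qed

text \<open>The first hypothesis leaves only the velocities of \<open>X\<close>, \<open>L2\<close>
  and \<open>L3\<close>. Applied to the velocity, it removes the last two and leaves
  \<open>laplacian a (laplacian a L1) = 0\<close>, which self-adjointness reduces to
  \<open>laplacian a L1 = 0\<close>.\<close>

lemma detectability:
  assumes "residual_graph A \<rho> s \<bullet> residual_graph A \<rho> (ccr_field A B 0 \<rho> \<kappa> \<mu> a s) = 0"
    and "residual_graph A \<rho> (ccr_field A B 0 \<rho> \<kappa> \<mu> a s) \<bullet>
      residual_graph A \<rho> (ccr_field A B 0 \<rho> \<kappa> \<mu> a (ccr_field A B 0 \<rho> \<kappa> \<mu> a s)) = 0"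
  shows "ccr_field A B 0 \<rho> \<kappa> \<mu> a s = 0"
proof (cases s rule: prod_cases8)
  case (fields X Y U W Z L1 L2 L3)
  note s0 = dissipation_eq_0D[OF assms(1) fields]
  note lin0 = linear_stacked[THEN linear_0]
  have field: "ccr_field A B 0 \<rho> \<kappa> \<mu> a s =
    (- laplacian a L1, 0, 0, 0, 0, 0, U - laplacian a W,
      row_augs \<rho> Y - col_mults \<kappa> B X - laplacian a Z)"
    using s0 by (simp add: fields ccr_field_stacked Let_def lin0)
  note s1 = dissipation_eq_0D[OF assms(2) field]
  have "laplacian a (laplacian a L1) = 0"
    using s1(1) by (simp add: linear_neg[OF linear_laplacian])
  then have "laplacian a L1 \<bullet> laplacian a L1 = 0"
    by (simp add: laplacian_self_adjoint[OF weighted_adjacencyD(1)[OF adj]])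
  then show ?thesis using field s1(3,4) by (simp add: zero_prod_def)
qed

text \<open>A kernel state has no dissipation, so its \<open>L2\<close>, \<open>L3\<close> and
  residual vanish. The remaining \<open>Y\<close> and \<open>U\<close> terms combine, by
  adjointness, into the residual paired with the padded \<open>F\<close>.\<close>

lemma offset_orthogonal_kernel:
  assumes "ccr_field A B 0 \<rho> \<kappa> \<mu> a k = 0"
  shows "residual_graph A \<rho> k \<bullet> residual_graph A \<rho> (ccr_field A B F \<rho> \<kappa> \<mu> a 0) = 0"
proof (cases k rule: prod_cases8)
  case (fields X Y U W Z L1 L2 L3)
  note k0 = dissipation_eq_0D[OF _ fields]
  have "residual_graph A \<rho> k \<bullet> residual_graph A \<rho> (ccr_field A B 0 \<rho> \<kappa> \<mu> a k) = 0"
    by (simp add: assms linear_0[OF linear_residual_graph])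
  note k0 = k0[OF this]
  define f where "f = row_augs \<mu> F"
  have "block_mults \<rho> A Y \<bullet> f - U \<bullet> f = 0"
    using k0(2) by (simp flip: inner_diff_left)
  moreover have "ccr_field A B F \<rho> \<kappa> \<mu> a 0 = (0, block_mults_adjoint \<rho> A f, - f, 0, 0, 0, - f,
      row_augs \<rho> (block_mults_adjoint \<rho> A f))"
    unfolding zero_prod_def ccr_field_stacked Let_def
    by (simp add: f_def linear_stacked[THEN linear_0] linear_neg[OF linear_block_mults_adjoint])
  ultimately show ?thesis
    using k0 by (simp add: residual_graph_def fields inner_block_mults)
qed

lemma dissipative_ccr:
  "dissipative_affine_system (ccr_field A B 0 \<rho> \<kappa> \<mu> a) (residual_graph A \<rho>)
     (ccr_field A B F \<rho> \<kappa> \<mu> a 0)"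
proof (rule dissipative_affine_system.intro)
  show "norm y \<le> norm (residual_graph A \<rho> y)" for y :: "('m, 'r, 'p, 'q, 'n) state"
    unfolding residual_graph_def by (rule norm_fst_le)
qed (fact linear_ccr_field linear_residual_graph dissipation_nonpos detectability
    offset_orthogonal_kernel)+

end

section \<open>Equilibria are least squares solutions\<close>

text \<open>The normal equation makes the residual orthogonal to every change of the fitted matrix,
  so Pythagoras gives minimality.\<close>

lemma normal_equation_imp_least_squares:
  assumes "transpose A ** (A ** X ** B - F) ** transpose B = 0"
  shows "least_squares_solution A B F X"
proof -
  have "(norm (A ** X ** B - F))\<^sup>2 \<le> (norm (A ** X' ** B - F))\<^sup>2" for X'
  proof -
    define R where "R = A ** X ** B - F"
    define D where "D = A ** (X' - X) ** B"
    have "D \<bullet> R = (A ** (X' - X)) \<bullet> (R ** transpose B)"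
      unfolding D_def by (rule inner_matrix_mult_right)
    also have "\<dots> = (X' - X) \<bullet> (transpose A ** R ** transpose B)"
      by (simp only: inner_matrix_mult_left matrix_mul_assoc)
    finally have "D \<bullet> R = (X' - X) \<bullet> (transpose A ** R ** transpose B)" .
    then have "D \<bullet> R = 0" using assms by (simp add: R_def)
    moreover have "A ** X' ** B - F = R + D"
    proof -
      have "A ** (X + (X' - X)) ** B = A ** X ** B + D"
        unfolding D_def matrix_add_ldistrib
        by (simp add: vec_eq_iff matrix_matrix_mult_def distrib_right sum.distrib)
      then show ?thesis by (simp add: R_def)
    qed
    ultimately have "(norm (A ** X' ** B - F))\<^sup>2 = (norm R)\<^sup>2 + (norm D)\<^sup>2"
      by (simp add: power2_norm_eq_inner inner_add_left inner_add_right inner_commute)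
    then show ?thesis by (simp add: R_def)
  qed
  then show ?thesis
    unfolding least_squares_solution_def is_arg_min_def by (auto simp: not_less)
qed

text \<open>At rest \<open>X\<close>, \<open>L2\<close> and \<open>L3\<close> have reached consensus
  values \<open>x\<close>, \<open>l2\<close>, \<open>l3\<close>. Summing over agents gives
  \<open>l3 ** transpose B = 0\<close>, \<open>Y = x ** B\<close> and a residual proportional to
  \<open>l2\<close>, while the equation for \<open>Y\<close> links \<open>l2\<close> to
  \<open>l3\<close> through \<open>transpose A\<close>.\<close>

lemma equilibrium_least_squares:
  fixes A :: "real ^ 'r::finite ^ 'm::finite" and B :: "real ^ 'q::finite ^ 'p::finite"
    and \<rho> :: "'r \<Rightarrow> 'n::finite"
  assumes adj: "weighted_adjacency E a" and conn: "graph_connected E"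
    and eq: "ccr_field A B F \<rho> \<kappa> \<mu> a z = 0"
  shows "least_squares_solution A B F (fst z $ i0)"
proof (cases z rule: prod_cases8)
  case (fields X Y U W Z L1 L2 L3)
  define e where "e = block_mults \<rho> A Y - row_augs \<mu> F - U"
  have zero: "laplacian a X = 0" "laplacian a L2 = 0" "laplacian a L3 = 0" "e = L2"
    and Xeq: "col_mults_adjoint \<kappa> B L3 = laplacian a L1"
    and Yeq: "- block_mults_adjoint \<rho> A e - row_augs_adjoint \<rho> L3 = 0"
    and L2eq: "U = laplacian a W"
    and L3eq: "row_augs \<rho> Y = col_mults \<kappa> B X + laplacian a Z"
    using eq unfolding fields ccr_field_stacked Let_def zero_prod_def
    by (auto simp: e_def algebra_simps linear_stacked[THEN linear_0])
  have consensus: "V $ i = V $ i0" if "laplacian a V = 0" for V :: "'v::real_inner ^ 'n" and i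
    using laplacian_inner_eq_0D(1)[OF adj conn, of V i i0] that by simp
  define x where "x = X $ i0"
  define l2 where "l2 = L2 $ i0"
  define l3 where "l3 = L3 $ i0"
  have X: "X $ i = x" and L2: "L2 $ i = l2" and L3: "L3 $ i = l3" for i
    using zero consensus by (simp_all add: x_def l2_def l3_def)
  have sum_lap: "(\<Sum>i\<in>UNIV. laplacian a V $ i) = 0" for V :: "'v::real_inner ^ 'n"
    using sum_coupling[OF weighted_adjacencyD(1)[OF adj]] by (simp add: laplacian_def)
  have l3_B: "l3 ** transpose B = 0"
  proof -
    have "l3 ** transpose B = (\<Sum>i\<in>UNIV. l3 ** transpose (col_aug \<kappa> i B))"
      unfolding matrix_mult_sum_right
      by (subst (1) sum_col_aug[symmetric, of B \<kappa>])
        (simp add: vec_eq_iff transpose_def matrix_matrix_mult_def)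
    also have "\<dots> = (\<Sum>i\<in>UNIV. laplacian a L1 $ i)"
      by (simp add: L3 col_mults_adjoint_def flip: Xeq)
    finally show ?thesis by (simp add: sum_lap)
  qed
  have Y: "Y = x ** B"
  proof -
    have "Y = (\<Sum>i\<in>UNIV. row_augs \<rho> Y $ i)" by (simp add: row_augs_def sum_row_aug)
    also have "\<dots> = (\<Sum>i\<in>UNIV. x ** col_aug \<kappa> i B)"
      by (simp add: L3eq sum.distrib sum_lap col_mults_def X)
    finally show ?thesis by (simp add: matrix_mult_sum_right sum_col_aug)
  qed
  have residual: "A ** x ** B - F = of_nat CARD('n) *\<^sub>R l2"
  proof -
    \<comment> \<open>The auxiliary \<open>U\<close> drops out, since \<open>L2eq\<close> makes it a
      Laplacian image with zero sum.\<close>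
    have "(\<Sum>i\<in>UNIV. e $ i) = A ** Y - F"
      by (simp add: e_def L2eq sum_subtractf sum_lap block_mults_def block_mult_eq row_augs_def
          matrix_mult_sum_right sum_row_aug)
    moreover have "(\<Sum>i\<in>UNIV. e $ i) = of_nat CARD('n) *\<^sub>R l2"
      by (simp add: zero(4) L2 sum_constant_scaleR del: sum_constant)
    ultimately show ?thesis by (simp add: Y matrix_mul_assoc)
  qed
  \<comment> \<open>Each row of \<open>Yeq\<close> involves only the agent owning that row; with
    consensus the rows assemble into one full matrix equation.\<close>
  have "- (transpose A ** l2) = l3"
    using Yeq by (simp add: zero(4) vec_eq_iff block_mults_adjoint_def row_augs_adjoint_def L2 L3)
  then have "transpose A ** l2 = - l3" by (metis minus_minus)
  then have "transpose A ** (A ** x ** B - F) ** transpose B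
      = of_nat CARD('n) *\<^sub>R ((- l3) ** transpose B)"
    by (simp only: residual matrix_scalar_ac flip: scalar_matrix_assoc)
  also have "\<dots> = 0"
    using l3_B by (simp add: vec_eq_iff matrix_matrix_mult_def sum_negf)
  finally show ?thesis
    by (intro normal_equation_imp_least_squares) (simp add: fields x_def)
qed

section \<open>Boundedness and assembly of the result\<close>

lemma bounded_if_converges_exponentially:
  fixes x :: "real \<Rightarrow> 's::metric_space"
  assumes "converges_exponentially x z"
  shows "bounded (x ` {0..})"
proof -
  obtain c \<nu> where c: "c \<ge> 0" "\<nu> > 0" "\<And>t. t \<ge> 0 \<Longrightarrow> dist (x t) z \<le> c * exp (- \<nu> * t)"
    using assms unfolding converges_exponentially_def by blast
  have "dist z (x t) \<le> c" if "t \<ge> 0" for t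
  proof -
    have "c * exp (- \<nu> * t) \<le> c * 1"
      using c(1,2) that by (intro mult_left_mono) auto
    then show ?thesis using c(3)[OF that] by (simp add: dist_commute)
  qed
  then show ?thesis unfolding bounded_def by (intro exI[of _ z] exI[of _ c]) auto
qed

theorem mainTheorem7:
  fixes A :: "real ^ 'r::finite ^ 'm::finite"
    and B :: "real ^ 'q::finite ^ 'p::finite"
    and F :: "real ^ 'q ^ 'm"
    and \<rho> :: "'r \<Rightarrow> 'n::finite" and \<kappa> :: "'q \<Rightarrow> 'n" and \<mu> :: "'m \<Rightarrow> 'n"
    and E :: "'n set set" and a :: "real ^ 'n ^ 'n"
  assumes "undirected_graph E"
    and "weighted_adjacency E a"
    and "graph_connected E"
  defines "f \<equiv> ccr_field A B F \<rho> \<kappa> \<mu> a"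
  shows "(\<forall>z. is_equilibrium f z \<longrightarrow> lyapunov_stable f z) \<and>
         (\<forall>x. is_trajectory f x \<longrightarrow> bounded (x ` {0..})) \<and>
         (\<forall>x. is_trajectory f x \<longrightarrow>
            (\<exists>z. is_equilibrium f z \<and> converges_exponentially x z) \<and>
            (\<forall>i. \<exists>Xs. least_squares_solution A B F Xs \<and>
                 converges_exponentially (\<lambda>t. fst (x t) $ i) Xs))"
proof -
  note adj = \<open>weighted_adjacency E a\<close> and conn = \<open>graph_connected E\<close>
  interpret dissipative_affine_system "ccr_field A B 0 \<rho> \<kappa> \<mu> a" "residual_graph A \<rho>"
      "ccr_field A B F \<rho> \<kappa> \<mu> a 0"
    by (rule dissipative_ccr[OF adj conn])
  have f: "f = (\<lambda>s. ccr_field A B 0 \<rho> \<kappa> \<mu> a s + ccr_field A B F \<rho> \<kappa> \<mu> a 0)"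
    unfolding f_def by (rule ext) (rule ccr_field_affine)
  have stable: "lyapunov_stable f z" if "is_equilibrium f z" for z
    using that equilibrium_lyapunov_stable[of z] unfolding f is_equilibrium_def by blast
  have conv: "\<exists>z. is_equilibrium f z \<and> converges_exponentially x z" if "is_trajectory f x" for x
    using that trajectory_converges[of x] unfolding f is_equilibrium_def by blast
  have X_conv: "\<exists>Xs. least_squares_solution A B F Xs \<and>
      converges_exponentially (\<lambda>t. fst (x t) $ i) Xs" if x: "is_trajectory f x" for x i
  proof -
    obtain z where z: "is_equilibrium f z" "converges_exponentially x z" using conv[OF x] by blast
    \<comment> \<open>Projection to the component of one agent is nonexpansive, so it inherits the
      rate of the whole state.\<close>
    have "dist (fst (x t) $ i) (fst z $ i) \<le> dist (x t) z" for t
      using dist_vec_nth_le[of "fst (x t)" i "fst z"] dist_fst_le[of "x t" z] by linarith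
    then have "converges_exponentially (\<lambda>t. fst (x t) $ i) (fst z $ i)"
      using z(2) unfolding converges_exponentially_def by (meson order_trans)
    moreover have "least_squares_solution A B F (fst z $ i)"
      using z(1) equilibrium_least_squares[OF adj conn] by (simp add: f_def is_equilibrium_def)
    ultimately show ?thesis by blast
  qed
  show ?thesis
    using stable conv X_conv bounded_if_converges_exponentially by blast
qed

end
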